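(* Let $\{F^1_t\}_{t\ge0}$ and $\{F^2_t\}_{t\ge0}$ be one-dimensional symmetric nice Feller processes with symbols $q_1(x,\xi)$ and $q_2(x,\xi)$ and Lévy measures $\nu_1(x,dy)$ and $\nu_2(x,dy)$, respectively. Assume that (i) $\nu_1(x,dy)$ is quasi-unimodal uniformly in $x\in\mathbb{R}$; (ii) $\nu_1(x,dy)$ has a bigger tail than $\nu_2(x,dy)$ uniformly in $x\in\mathbb{R}$, i.e. there is $y_1>0$ such that $\nu_1(x,(y,\infty))\ge\nu_2(x,(y,\infty))$ for all $x\in\mathbb{R}$ and all $y\ge y_1$; (iii) the function $x\mapsto\nu_1(x,O-x)$ is lower semicontinuous for every open set $O\subseteq\mathbb{R}$. Then, for arbitrary $r>0$, $$\int_{\{|\xi|<r\}}\frac{d\xi}{\sup_{x\in\mathbb{R}}q_1(x,\xi)}=\infty\quad\text{implies}\quad\int_{\{|\xi|<r\}}\frac{d\xi}{\sup_{x\in\mathbb{R}}q_2(x,\xi)}=\infty.$$ In addition, if $\lim_{\xi\to0}\frac{\inf_{x\in\mathbb{R}}q_1(x,\xi)}{\xi^2}=\infty$ and $\inf_{x\in\mathbb{R}}\int_{y_0}^\infty y\,\nu_1(x,(y,\infty))\,dy>0$ for some $y_0>0$, then, for all $r>0$ small enough, $$\int_{\{|\xi|<r\}}\frac{d\xi}{\inf_{x\in\mathbb{R}}q_2(x,\xi)}<\infty\quad\text{implies}\quad\int_{\{|\xi|<r\}}\frac{d\xi}{\inf_{x\in\mathbb{R}}q_1(x,\xi)}<\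infty.$$
   Context: A symmetric Borel measure $\mu$ on $\mathbb{R}$ is quasi-unimodal if there is $y_0\ge0$ such that $y\mapsto\mu((y,\infty))$ is a (finite) convex function on $(y_0,\infty)$. A kernel $\nu(x,dy)$ of symmetric measures is quasi-unimodal uniformly in $x$ if one $y_0\ge0$ works for all $\nu(x,\cdot)$, $x\in\mathbb{R}$. A Feller process $\{F_t\}_{t\ge0}$ on $\mathbb{R}$ is a Markov process with state space $(\mathbb{R},\mathcal{B}(\mathbb{R}))$, with laws $\mathbb{P}^x$ and expectations $\mathbb{E}^x$, whose semigroup $P_tf(x)=\mathbb{E}^x[f(F_t)]$ maps $C_\infty(\mathbb{R})$ (continuous functions vanishing at infinity, with the supremum norm) into itself and is strongly continuous there; it is strong Markov with càdlàg paths. Let $(\mathcal{A},\mathcal{D}_{\mathcal{A}})$ be its generator. Condition (C1): $C_c^\infty(\mathbb{R})\subseteq\mathcal{D}_{\mathcal{A}}$; then for $f\in C_c^\infty(\mathbb{R})$, $\mathcal{A}f(x)=-\int_{\mathbb{R}}q(x,\xi)e^{i\xi x}\hat f(\xi)\,d\xi$, $\hat f(\xi)=(2\pi)^{-1}\int e^{-i\xi x}f(x)\,dx$, where the symbol $q$ has a Lévy-Khintchine representation $q(x,\xi)=a(x)-i\xi b(x)+\frac12c(x)\xi^2-\int_{\mathbb{R}}(e^{i\xi y}-1-i\xi y1_{\{|y|\le1\}})\nu(x,dy)$, with $a,c\ge0$ and $b$ real-valued Borel functions and $\nu(x,dy)$ a Borel kernel (the Lévy measure) with $\nu(x,\{0\})=0$,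 $\int\min\{1,y^2\}\nu(x,dy)<\infty$. Condition (C2): for some $C\ge0$, $\sup_x|q(x,\xi)|\le C(1+\xi^2)$ for all $\xi$; equivalently $a$, $b$, $c$ and $x\mapsto\int\min\{1,y^2\}\nu(x,dy)$ are bounded. Condition (C3): $q(x,0)=a(x)=0$ for all $x$. For a $\sigma$-finite measure $\varphi$ the process is $\varphi$-irreducible if $\varphi(B)>0$ implies $\int_0^\infty\mathbb{P}^x(F_t\in B)\,dt>0$ for all $x$; then there is a maximal irreducibility measure $\psi$ (the process is $\bar\varphi$-irreducible iff $\bar\varphi\ll\psi$). Condition (C4): the process is irreducible and $\psi(O)>0$ for every nonempty open $O\subseteq\mathbb{R}$. A nice Feller process is a Feller process satisfying (C1)-(C4). It is symmetric if $q=\operatorname{Re}q$, i.e. $b=0$ and each $\nu(x,dy)$ is a symmetric measure, so that $q(x,\xi)=\frac12c(x)\xi^2+\int_{\mathbb{R}}(1-\cos\xi y)\nu(x,dy)\ge0$. Convention: $1/0=\infty$ in integrands. *)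

theory Defs
  imports "HOL-Probability.Probability"
begin

definition C_infty :: "(real \<Rightarrow> real) set" where
  "C_infty = {f. continuous_on UNIV f \<and> (f \<longlongrightarrow> 0) at_infinity}"

definition C_c_smooth :: "(real \<Rightarrow> real) set" where
  "C_c_smooth = {f. (\<forall>n x. (deriv ^^ n) f field_differentiable at x) \<and>
                    compact (closure {x. f x \<noteq> 0})}"

definition fourier :: "(real \<Rightarrow> real) \<Rightarrow> real \<Rightarrow> complex" where
  "fourier f \<xi> = 1 / (2 * of_real pi) * (\<integral>x. exp (- (\<i> * of_real (\<xi> * x))) * of_real (f x) \<partial>lborel)"

definition lower_semicontinuous :: "(real \<Rightarrow> ennreal) \<Rightarrow> bool" where
  "lower_semicontinuous f \<longleftrightarrow> (\<forall>x. f x \<le> Liminf (at x) f)"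

definition cadlag :: "(real \<Rightarrow> real) \<Rightarrow> bool" where
  "cadlag p \<longleftrightarrow> (\<forall>t\<ge>0. continuous (at_right t) p) \<and> (\<forall>t>0. \<exists>l. (p \<longlongrightarrow> l) (at_left t))"

definition symmetric_measure :: "real measure \<Rightarrow> bool" where
  "symmetric_measure \<mu> \<longleftrightarrow> sets \<mu> = sets borel \<and>
     (\<forall>B\<in>sets borel. emeasure \<mu> (uminus ` B) = emeasure \<mu> B)"

definition quasi_unimodal_from :: "real \<Rightarrow> real measure \<Rightarrow> bool" where
  "quasi_unimodal_from y0 \<mu> \<longleftrightarrow> symmetric_measure \<mu> \<and>
     (\<forall>y>y0. emeasure \<mu> {y<..} < \<infinity>) \<and> convex_on {y0<..} (\<lambda>y. measure \<mu> {y<..})"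

definition uniformly_quasi_unimodal :: "(real \<Rightarrow> real measure) \<Rightarrow> bool" where
  "uniformly_quasi_unimodal \<nu> \<longleftrightarrow> (\<exists>y0\<ge>0. \<forall>x. quasi_unimodal_from y0 (\<nu> x))"

definition levy_kernel :: "(real \<Rightarrow> real measure) \<Rightarrow> bool" where
  "levy_kernel \<nu> \<longleftrightarrow>
     (\<forall>x. sets (\<nu> x) = sets borel) \<and>
     (\<forall>B\<in>sets borel. (\<lambda>x. emeasure (\<nu> x) B) \<in> borel_measurable borel) \<and>
     (\<forall>x. emeasure (\<nu> x) {0} = 0) \<and>
     (\<forall>x. (\<integral>\<^sup>+y. ennreal (min 1 (y\<^sup>2)) \<partial>\<nu> x) < \<infinity>)"

definition levy_symbol ::
  "(real \<Rightarrow> real) \<Rightarrow> (real \<Rightarrow> real) \<Rightarrow> (real \<Rightarrow> real) \<Rightarrow> (real \<Rightarrow> real measure) \<Rightarrow>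
   real \<Rightarrow> real \<Rightarrow> complex" where
  "levy_symbol a b c \<nu> x \<xi> =
     of_real (a x) - \<i> * of_real (\<xi> * b x) + of_real (c x * \<xi>\<^sup>2 / 2)
     - (\<integral>y. (exp (\<i> * of_real (\<xi> * y)) - 1 - \<i> * of_real (\<xi> * y * indicator {-1..1} y)) \<partial>\<nu> x)"

text \<open>
  \<open>P x\<close> is the law of the process started in \<open>x\<close>, a probability measure on the sample space \<open>M\<close>,
  and \<open>X t\<close> is the state at time \<open>t \<ge> 0\<close>; the values of \<open>X\<close> at negative times are irrelevant.
  The natural filtration is indexed by \<^typ>\<open>ennreal\<close>, so that stopping times may be infinite and
  the \<open>\<sigma>\<close>-algebra at \<open>\<infinity>\<close> is the one generated by the whole process.
\<close>

definition nat_filtration ::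
  "'w measure \<Rightarrow> (real \<Rightarrow> 'w \<Rightarrow> real) \<Rightarrow> ennreal \<Rightarrow> 'w measure" where
  "nat_filtration M X t =
     sigma (space M) {X u -` B \<inter> space M | u B. 0 \<le> u \<and> ennreal u \<le> t \<and> B \<in> sets borel}"

locale markov_process =
  fixes M :: "'w measure" and P :: "real \<Rightarrow> 'w measure" and X :: "real \<Rightarrow> 'w \<Rightarrow> real"
  assumes prob: "\<And>x. prob_space (P x)"
    and sets_P: "\<And>x. sets (P x) = sets M"
    and measurable_X: "\<And>t. 0 \<le> t \<Longrightarrow> X t \<in> borel_measurable M"
    and measurable_transition: "\<And>t B. 0 \<le> t \<Longrightarrow> B \<in> sets borel \<Longrightarrow>
          (\<lambda>x. emeasure (P x) {\<omega>\<in>space M. X t \<omega> \<in> B}) \<in> borel_measurable borel"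
    and start: "\<And>x. AE \<omega> in P x. X 0 \<omega> = x"
    and markov: "\<And>x s t A B. 0 \<le> s \<Longrightarrow> 0 \<le> t \<Longrightarrow>
          A \<in> sets (nat_filtration M X (ennreal s)) \<Longrightarrow> B \<in> sets borel \<Longrightarrow>
          emeasure (P x) {\<omega>\<in>A. X (s + t) \<omega> \<in> B} =
          (\<integral>\<^sup>+\<omega>\<in>A. emeasure (P (X s \<omega>)) {\<omega>'\<in>space M. X t \<omega>' \<in> B} \<partial>P x)"
begin

definition semigroup :: "real \<Rightarrow> (real \<Rightarrow> real) \<Rightarrow> real \<Rightarrow> real" where
  "semigroup t f x = (\<integral>\<omega>. f (X t \<omega>) \<partial>P x)"

text \<open>
  In \<open>has_generator f g\<close> and below, convergence in the supremum norm is uniform convergence on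
  \<^term>\<open>UNIV\<close>.
\<close>

definition has_generator :: "(real \<Rightarrow> real) \<Rightarrow> (real \<Rightarrow> real) \<Rightarrow> bool" where
  "has_generator f g \<longleftrightarrow> f \<in> C_infty \<and> g \<in> C_infty \<and>
     uniform_limit UNIV (\<lambda>t x. (semigroup t f x - f x) / t) g (at_right 0)"

definition generator_domain :: "(real \<Rightarrow> real) set" where
  "generator_domain = {f. \<exists>g. has_generator f g}"

definition generator :: "(real \<Rightarrow> real) \<Rightarrow> real \<Rightarrow> real" where
  "generator f = (THE g. has_generator f g)"

definition irreducible_wrt :: "real measure \<Rightarrow> bool" where
  "irreducible_wrt \<phi> \<longleftrightarrow> sets \<phi> = sets borel \<and> sigma_finite_measure \<phi> \<and>
     (\<forall>B\<in>sets borel. emeasure \<phi> B > 0 \<longrightarrow>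
        (\<forall>x. (\<integral>\<^sup>+t\<in>{0..}. emeasure (P x) {\<omega>\<in>space M. X t \<omega> \<in> B} \<partial>lborel) > 0))"

definition maximal_irreducibility_measure :: "real measure \<Rightarrow> bool" where
  "maximal_irreducibility_measure \<psi> \<longleftrightarrow> irreducible_wrt \<psi> \<and>
     (\<forall>\<phi>. sets \<phi> = sets borel \<and> sigma_finite_measure \<phi> \<longrightarrow>
        (irreducible_wrt \<phi> \<longleftrightarrow> absolutely_continuous \<psi> \<phi>))"

end

locale feller_process = markov_process +
  assumes feller: "\<And>t f. 0 \<le> t \<Longrightarrow> f \<in> C_infty \<Longrightarrow> semigroup t f \<in> C_infty"
    and strongly_continuous: "\<And>f. f \<in> C_infty \<Longrightarrow>
          uniform_limit UNIV (\<lambda>t. semigroup t f) f (at_right 0)"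
    and cadlag_paths: "\<And>\<omega>. \<omega> \<in> space M \<Longrightarrow> cadlag (\<lambda>t. X t \<omega>)"
    and strong_markov: "\<And>x T t A B. stopping_time (nat_filtration M X) T \<Longrightarrow> 0 \<le> t \<Longrightarrow>
          A \<in> sets (filtration.pre_sigma (space M) (nat_filtration M X) T) \<Longrightarrow> B \<in> sets borel \<Longrightarrow>
          emeasure (P x) {\<omega>\<in>A. T \<omega> < \<infinity> \<and> X (enn2real (T \<omega>) + t) \<omega> \<in> B} =
          (\<integral>\<^sup>+\<omega>\<in>{\<omega>\<in>A. T \<omega> < \<infinity>}.
             emeasure (P (X (enn2real (T \<omega>)) \<omega>)) {\<omega>'\<in>space M. X t \<omega>' \<in> B} \<partial>P x)"

locale nice_feller_process = feller_process M P X
  for M :: "'w measure" and P :: "real \<Rightarrow> 'w measure" and X :: "real \<Rightarrow> 'w \<Rightarrow> real" +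
  fixes a b c :: "real \<Rightarrow> real" and \<nu> :: "real \<Rightarrow> real measure"
  assumes borel_coeffs: "a \<in> borel_measurable borel" "b \<in> borel_measurable borel"
      "c \<in> borel_measurable borel"
    and nonneg_coeffs: "\<And>x. 0 \<le> a x" "\<And>x. 0 \<le> c x"
    and levy: "levy_kernel \<nu>"
    and C1_domain: "C_c_smooth \<subseteq> generator_domain"
    and C1_symbol: "\<And>f x. f \<in> C_c_smooth \<Longrightarrow>
          of_real (generator f x) =
          - (\<integral>\<xi>. levy_symbol a b c \<nu> x \<xi> * exp (\<i> * of_real (\<xi> * x)) * fourier f \<xi> \<partial>lborel)"
    and C2: "\<exists>C\<ge>0. \<forall>\<xi> x. norm (levy_symbol a b c \<nu> x \<xi>) \<le> C * (1 + \<xi>\<^sup>2)"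
    and C3: "\<And>x. levy_symbol a b c \<nu> x 0 = 0 \<and> a x = 0"
    and C4: "\<exists>\<psi>. maximal_irreducibility_measure \<psi> \<and>
          (\<forall>U. open U \<longrightarrow> U \<noteq> {} \<longrightarrow> emeasure \<psi> U > 0)"

text \<open>
  For a symbol, being real is equivalent to \<open>b = 0\<close> and symmetry of \<open>\<nu> x\<close>, by uniqueness of the
  Levy-Khintchine triplet; both forms of the condition are recorded.
\<close>

locale symmetric_nice_feller_process = nice_feller_process +
  assumes real_symbol: "\<And>x \<xi>. levy_symbol a b c \<nu> x \<xi> = of_real (Re (levy_symbol a b c \<nu> x \<xi>))"
    and no_drift: "\<And>x. b x = 0"
    and symmetric_levy: "\<And>x. symmetric_measure (\<nu> x)"

end

(*
  Write q_i = c_i xi^2 / 2 + J_i with J_i the integral of 1 - cos (xi y) against nu_i.  Since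
  1 - cos u is at most min 2 (u^2/2), the part of J_2 carried by |y| <= Y is O(xi^2) uniformly
  in x, and the rest is bounded by the integral of the increasing function min 1 ((xi y)^2)
  over the tail, which grows when nu_2 is replaced by nu_1.  Convexity of the tail of nu_1 makes
  the masses of successive intervals of equal length decrease, so the half periods on which
  1 - cos (xi y) >= 1 carry at least half of the tail mass; hence the tail integral for nu_1 is
  bounded by a multiple of J_1.  Altogether q_2 <= B xi^2 + K q_1 uniformly in x and xi.

  For the second implication B xi^2 is absorbed because inf q_1 / xi^2 tends to infinity.  For the
  first, either all nu_1(x, .), and therefore all nu_2(x, .), live on one bounded interval, so
  that q_2 <= B xi^2 and 1 / sup q_2 is not integrable at 0; or some nu_1(x, .) reaches far enough
  for q_1(x, xi) >= delta min 1 (xi^2), which absorbs B xi^2 on bounded sets.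
*)

theory Submission
  imports Defs
begin

section \<open>Elementary estimates for the cosine\<close>

lemma one_minus_cos_le: "1 - cos u \<le> u\<^sup>2 / 2" for u :: real
proof -
  have "cos u = 1 - 2 * (sin (u / 2))\<^sup>2"
    using cos_double_sin[of "u / 2"] by simp
  moreover have "(sin (u / 2))\<^sup>2 \<le> (u / 2)\<^sup>2"
    using abs_sin_x_le_abs_x[of "u / 2"] by (simp only: abs_le_square_iff)
  ultimately show ?thesis by (simp add: power_divide)
qed

text \<open>The half-angle formula \<open>1 - cos u = 2 * (sin v)\<^sup>2\<close> with
  \<open>v = \<bar>u\<bar> / 2\<close> reduces this to a linear lower bound for the sine. For
  \<open>0 \<le> v \<le> 1\<close> the cubic Taylor bound gives
  \<open>sin v \<ge> 5 / 6 * v\<close>, which after squaring leaves room for the round constant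
  4.\<close>

lemma square_le_one_minus_cos:
  fixes u :: real
  assumes "\<bar>u\<bar> \<le> pi / 2"
  shows "u\<^sup>2 \<le> 4 * (1 - cos u)"
proof -
  define v where "v = \<bar>u\<bar> / 2"
  have v: "0 \<le> v" "v \<le> 1" using assms pi_half_less_two by (auto simp: v_def)
  have "\<bar>sin v - (\<Sum>m<3. sin_coeff m * v ^ m)\<bar> \<le> inverse (fact 3) * \<bar>v\<bar> ^ 3"
    by (rule Maclaurin_sin_bound)
  moreover have "(\<Sum>m<3. sin_coeff m * v ^ m) = v"
    by (simp add: numeral_3_eq_3 sin_coeff_def)
  ultimately have "v - v ^ 3 / 6 \<le> sin v"
    using v by (simp add: fact_numeral abs_if split: if_splits)
  moreover have "v ^ 3 \<le> v" using power_decreasing[of 1 3 v] v by simp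
  ultimately have "5 / 6 * v \<le> sin v" by simp
  then have "(5 / 6 * v)\<^sup>2 \<le> (sin v)\<^sup>2" using v by (intro power_mono) auto
  then have "v\<^sup>2 \<le> 2 * (sin v)\<^sup>2"
    by (simp add: power_mult_distrib power_divide) (use zero_le_power2[of v] in linarith)
  moreover have "cos u = 1 - 2 * (sin v)\<^sup>2"
    using cos_double_sin[of "v"] by (simp add: v_def)
  ultimately show ?thesis by (simp add: v_def power_divide)
qed

lemma cos_nonpos_half_period:
  fixes \<xi> w y :: real
  assumes "\<xi> * w = pi / 2 + 2 * pi * real k" "0 < \<xi>" "w < y" "y \<le> w + pi / \<xi>"
  shows "cos (\<xi> * y) \<le> 0"
proof -
  define t where "t = \<xi> * (y - w)"
  have t: "0 \<le> t" "t \<le> pi"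
    using assms by (auto simp: t_def field_simps)
  \<comment> \<open>The phase is written this way so that a shift by \<open>pi\<close> leaves the
    argument \<open>t - pi / 2\<close>, which lies in \<open>[-pi/2, pi/2]\<close>, where the cosine
    is nonnegative.\<close>
  have "\<xi> * y = (t - pi / 2) + pi + 2 * pi * real k"
    using assms(1) by (simp add: t_def algebra_simps)
  moreover have "cos (2 * pi * real k) = 1" "sin (2 * pi * real k) = 0"
    using cos_2npi[of k] sin_2npi[of k] by (simp_all only: mult.assoc mult.commute[of pi])
  ultimately have "cos (\<xi> * y) = cos ((t - pi / 2) + pi)"
    by (simp only: cos_add[of _ "2 * pi * real k"] mult_1_right mult_zero_right diff_zero)
  also have "\<dots> = - cos (t - pi / 2)" by (rule cos_periodic_pi)
  finally show ?thesis using t by (simp add: cos_ge_zero)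
qed

section \<open>Tails of quasi-unimodal measures against their jump part\<close>

text \<open>The mass of \<open>(y, y+h]\<close> is a decrement of the tail function over a step of
  length \<open>h\<close>, and a convex function has decrements that shrink to the right.\<close>

lemma quasi_unimodal_interval_antimono:
  assumes "quasi_unimodal_from y0 \<mu>" "y0 < a" "a \<le> b" "0 \<le> h"
  shows "emeasure \<mu> {b<..b+h} \<le> emeasure \<mu> {a<..a+h}"
proof -
  let ?N = "\<lambda>y. measure \<mu> {y<..}"
  have [measurable_cong]: "sets \<mu> = sets borel"
    using assms(1) by (simp add: quasi_unimodal_from_def symmetric_measure_def)
  have fin: "emeasure \<mu> {y<..} \<noteq> \<infinity>" if "y0 < y" for y
    using assms(1) that by (auto simp: quasi_unimodal_from_def)
  have conv: "convex_on {y0<..} ?N"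
    using assms(1) by (simp add: quasi_unimodal_from_def)
  have eq: "emeasure \<mu> {y<..y+h} = ennreal (?N y - ?N (y+h))" if "y0 < y" for y
  proof -
    have "{y<..y+h} = {y<..} - {y+h<..}" by auto
    then have "emeasure \<mu> {y<..y+h} = emeasure \<mu> {y<..} - emeasure \<mu> {y+h<..}"
      using assms(4) fin[of "y+h"] that by (simp add: emeasure_Diff)
    also have "\<dots> = ennreal (?N y - ?N (y+h))"
      using fin[of y] fin[of "y+h"] that assms(4)
      by (simp add: emeasure_eq_ennreal_measure ennreal_minus)
    finally show ?thesis .
  qed
  have "?N (a+h) + ?N b \<le> ?N a + ?N (b+h)"
  proof (cases "b - a + h = 0")
    case True
    then have "a = b" "h = 0" using assms by auto
    then show ?thesis by simp
  next
    case False
    \<comment> \<open>The points \<open>a + h\<close> and \<open>b\<close> both lie between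
      \<open>a\<close> and \<open>b + h\<close>, with barycentric weights that are interchanged:
      \<open>l\<close> for one, \<open>1 - l\<close> for the other. Adding the two convexity
      inequalities makes the weights sum to one at each endpoint.\<close>
    define l where "l = h / (b - a + h)"
    have pos: "0 < b - a + h" using False assms by auto
    have l: "0 \<le> l" "l \<le> 1" using assms pos by (auto simp: l_def)
    have lh: "l * (b - a + h) = h" using pos by (simp add: l_def)
    have "?N ((1 - l) *\<^sub>R a + l *\<^sub>R (b+h)) \<le> (1 - l) * ?N a + l * ?N (b+h)"
      using assms l by (intro convex_onD[OF conv]) auto
    moreover have "(1 - l) *\<^sub>R a + l *\<^sub>R (b+h) = a + h"
      using lh by (simp add: algebra_simps)
    moreover have "?N ((1 - (1 - l)) *\<^sub>R a + (1 - l) *\<^sub>R (b+h)) \<le> (1 - (1 - l)) * ?N a + (1 - l) * ?N (b+h)"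
      using assms l by (intro convex_onD[OF conv]) auto
    moreover have "(1 - (1 - l)) *\<^sub>R a + (1 - l) *\<^sub>R (b+h) = b"
      using lh by (simp add: algebra_simps)
    ultimately show ?thesis by (simp add: algebra_simps)
  qed
  then show ?thesis
    using assms by (simp add: eq ennreal_leI)
qed

definition jump_part :: "real measure \<Rightarrow> real \<Rightarrow> ennreal" where
  "jump_part \<mu> \<xi> = (\<integral>\<^sup>+y. ennreal (1 - cos (\<xi> * y)) \<partial>\<mu>)"

text \<open>The intervals \<open>(w, w + pi/\<xi>]\<close> with \<open>\<xi> w = pi/2\<close> modulo \<open>2 pi\<close> are those on which
  \<open>1 - cos (\<xi> y) \<ge> 1\<close>; beyond \<open>y0\<close> each of them carries at least as much mass as the
  interval of the same length that follows it.\<close>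

lemma tail_le_jump_part:
  assumes qu: "quasi_unimodal_from y0 \<mu>" and "0 < \<xi>" "y0 < z"
    and z: "\<xi> * z = pi / 2 + 2 * pi * real k"
  shows "emeasure \<mu> {z<..} \<le> 2 * jump_part \<mu> \<xi>"
proof -
  have [measurable_cong]: "sets \<mu> = sets borel"
    using qu by (simp add: quasi_unimodal_from_def symmetric_measure_def)
  define h where "h = pi / \<xi>"
  have h: "0 < h" "\<xi> * h = pi" using assms by (auto simp: h_def)
  \<comment> \<open>With \<open>1 - cos\<close> as a density, the jump part is the total mass of
    \<open>\<kappa>\<close>, and summing over periods becomes additivity of two measures.\<close>
  define \<kappa> where "\<kappa> = density \<mu> (\<lambda>y. ennreal (1 - cos (\<xi> * y)))"
  have [measurable_cong]: "sets \<kappa> = sets borel"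
    by (simp add: \<kappa>_def \<open>sets \<mu> = sets borel\<close>)
  have period: "emeasure \<mu> {w<..w + 2 * h} \<le> 2 * emeasure \<kappa> {w<..w + 2 * h}"
    if w: "y0 < w" "\<xi> * w = pi / 2 + 2 * pi * real j" for w j
  proof -
    have "emeasure \<mu> {w<..w+h} = (\<integral>\<^sup>+y. indicator {w<..w+h} y \<partial>\<mu>)" by simp
    also have "\<dots> \<le> (\<integral>\<^sup>+y. ennreal (1 - cos (\<xi> * y)) * indicator {w<..w+2*h} y \<partial>\<mu>)"
      using h cos_nonpos_half_period[OF w(2) \<open>0 < \<xi>\<close>]
      by (intro nn_integral_mono) (auto simp: indicator_def h_def ennreal_ge_1)
    also have "\<dots> = emeasure \<kappa> {w<..w+2*h}"
      by (simp add: \<kappa>_def emeasure_density)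
    finally have *: "emeasure \<mu> {w<..w+h} \<le> emeasure \<kappa> {w<..w+2*h}" .
    have "{w<..w + 2 * h} = {w<..w+h} \<union> {w+h<..(w+h)+h}" using h by auto
    then have "emeasure \<mu> {w<..w + 2 * h} = emeasure \<mu> {w<..w+h} + emeasure \<mu> {w+h<..(w+h)+h}"
      by (simp only:) (rule plus_emeasure[symmetric], auto)
    \<comment> \<open>Quasi-unimodality: the bad half period carries at most the mass of the good
      one before it. This is the origin of the factor 2.\<close>
    also have "\<dots> \<le> emeasure \<mu> {w<..w+h} + emeasure \<mu> {w<..w+h}"
      using h w by (intro add_left_mono quasi_unimodal_interval_antimono[OF qu]) auto
    also have "\<dots> \<le> emeasure \<kappa> {w<..w+2*h} + emeasure \<kappa> {w<..w+2*h}"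
      by (intro add_mono *)
    finally show ?thesis by (simp only: mult_2)
  qed
  have many: "emeasure \<mu> {z<..z + 2 * h * real n} \<le> 2 * emeasure \<kappa> {z<..z + 2 * h * real n}" for n
  proof (induction n)
    case (Suc n)
    let ?w = "z + 2 * h * real n"
    have nn: "0 \<le> 2 * h * real n" using h by simp
    have "z + 2 * h * real (Suc n) = ?w + 2 * h" by (simp add: algebra_simps)
    then have split: "{z<..z + 2 * h * real (Suc n)} = {z<..?w} \<union> {?w<..?w + 2 * h}"
      using h nn by (simp only: ivl_disj_un_two(6) le_add_same_cancel1 mult_pos_pos less_imp_le zero_less_numeral)
    \<comment> \<open>Advancing by \<open>n\<close> full periods preserves the phase condition, with
      \<open>k + n\<close> in place of \<open>k\<close>.\<close>
    have "\<xi> * ?w = pi / 2 + 2 * pi * real (k + n)"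
      using z h by (simp add: algebra_simps)
    then have *: "emeasure \<mu> {?w<..?w + 2 * h} \<le> 2 * emeasure \<kappa> {?w<..?w + 2 * h}"
      using nn assms by (intro period[of _ "k + n"]) linarith+
    have "emeasure \<mu> {z<..z + 2 * h * real (Suc n)} = emeasure \<mu> {z<..?w} + emeasure \<mu> {?w<..?w + 2 * h}"
      unfolding split by (rule plus_emeasure[symmetric]) auto
    also have "\<dots> \<le> 2 * emeasure \<kappa> {z<..?w} + 2 * emeasure \<kappa> {?w<..?w + 2 * h}"
      by (intro add_mono Suc *)
    also have "\<dots> = 2 * emeasure \<kappa> ({z<..?w} \<union> {?w<..?w + 2 * h})"
      unfolding distrib_left[symmetric] by (intro arg_cong[where f="\<lambda>a. 2 * a"] plus_emeasure) auto
    finally show ?case unfolding split .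
  qed simp
  have "{z<..} = (\<Union>n. {z<..z + 2 * h * real n})"
  proof safe
    fix y assume "z < y"
    obtain n where "(y - z) / (2 * h) \<le> real n" using real_arch_simple by blast
    then show "y \<in> (\<Union>n. {z<..z + 2 * h * real n})"
      using h \<open>z < y\<close> by (auto simp: field_simps intro!: exI[of _ n])
  qed auto
  moreover have "incseq (\<lambda>n. {z<..z + 2 * h * real n})"
    using h by (auto simp: incseq_def elim!: order_trans)
  ultimately have "emeasure \<mu> {z<..} = (SUP n. emeasure \<mu> {z<..z + 2 * h * real n})"
    by (simp add: SUP_emeasure_incseq image_subset_iff)
  also have "\<dots> \<le> 2 * emeasure \<kappa> UNIV"
    by (intro SUP_least order_trans[OF many] mult_left_mono emeasure_mono) auto
  also have "emeasure \<kappa> UNIV = jump_part \<mu> \<xi>"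
    by (simp add: \<kappa>_def jump_part_def emeasure_density)
  finally show ?thesis .
qed

text \<open>Low frequencies. The first point \<open>z\<close> of phase \<open>pi / 2\<close> lies at
  or beyond \<open>Y\<close>. Up to \<open>z\<close> the square is at most
  \<open>4 * (1 - cos (\<xi> * y))\<close>; beyond \<open>z\<close> the truncation leaves only the
  tail mass, which costs another 2, hence 6.\<close>

lemma truncated_square_le_jump_part:
  assumes qu: "quasi_unimodal_from y0 \<mu>" and Y: "y0 < Y" "0 < Y"
    and \<xi>: "0 < \<xi>" "\<xi> \<le> pi / (2 * Y)"
  shows "(\<integral>\<^sup>+y\<in>{Y<..}. ennreal (min 1 ((\<xi> * y)\<^sup>2)) \<partial>\<mu>) \<le> 6 * jump_part \<mu> \<xi>"
proof -
  have [measurable_cong]: "sets \<mu> = sets borel"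
    using qu by (simp add: quasi_unimodal_from_def symmetric_measure_def)
  define z where "z = pi / (2 * \<xi>)"
  have z: "Y \<le> z" "\<xi> * z = pi / 2 + 2 * pi * real 0"
    using Y \<xi> by (auto simp: z_def field_simps)
  have "(\<integral>\<^sup>+y\<in>{Y<..}. ennreal (min 1 ((\<xi> * y)\<^sup>2)) \<partial>\<mu>)
      \<le> (\<integral>\<^sup>+y. 4 * ennreal (1 - cos (\<xi> * y)) + indicator {z<..} y \<partial>\<mu>)"
  proof (intro nn_integral_mono)
    fix y
    consider "y \<le> Y" | "z < y" | "Y < y" "y \<le> z" by linarith
    then show "ennreal (min 1 ((\<xi> * y)\<^sup>2)) * indicator {Y<..} y
        \<le> 4 * ennreal (1 - cos (\<xi> * y)) + indicator {z<..} y"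
    proof cases
      case 2
      then show ?thesis using z
        by (auto intro!: add_increasing simp: ennreal_le_1)
    next
      case 3
      have "\<bar>\<xi> * y\<bar> \<le> pi / 2"
        using 3 Y \<xi> by (simp add: z_def field_simps)
      then have "min 1 ((\<xi> * y)\<^sup>2) \<le> 4 * (1 - cos (\<xi> * y))"
        by (intro min.coboundedI2 square_le_one_minus_cos)
      then have "ennreal (min 1 ((\<xi> * y)\<^sup>2)) \<le> ennreal 4 * ennreal (1 - cos (\<xi> * y))"
        by (subst ennreal_mult[symmetric]) (auto simp del: ennreal_numeral)
      then show ?thesis using 3 by simp
    qed auto
  qed
  also have "\<dots> = 4 * jump_part \<mu> \<xi> + emeasure \<mu> {z<..}"
    unfolding jump_part_def by (subst nn_integral_add) (auto simp: nn_integral_cmult)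
  also have "\<dots> \<le> 4 * jump_part \<mu> \<xi> + 2 * jump_part \<mu> \<xi>"
    using z Y \<xi> by (intro add_left_mono tail_le_jump_part[OF qu, of _ _ 0]) auto
  finally show ?thesis by (simp flip: distrib_right)
qed

text \<open>The counterpart for high frequencies, with the same threshold
  \<open>pi / (2 * Y)\<close>. A point of phase \<open>pi / 2\<close> can be found past
  \<open>Y\<close> at a distance of at most one and a quarter periods, that is \<open>5 * Y\<close>,
  hence the tail from \<open>6 * Y\<close>.\<close>

lemma far_tail_le_jump_part:
  assumes qu: "quasi_unimodal_from y0 \<mu>" and Y: "y0 < Y" "0 < Y"
    and \<xi>: "pi / (2 * Y) \<le> \<xi>"
  shows "emeasure \<mu> {6 * Y<..} \<le> 2 * jump_part \<mu> \<xi>"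
proof -
  have [measurable_cong]: "sets \<mu> = sets borel"
    using qu by (simp add: quasi_unimodal_from_def symmetric_measure_def)
  have pos: "0 < \<xi>" using \<xi> Y by (smt (verit) divide_pos_pos pi_gt_zero)
  \<comment> \<open>a period is at most \<open>4 * Y\<close>, so some good half period starts in \<open>(Y, 6 * Y]\<close>\<close>
  define p where "p = 2 * pi / \<xi>"
  have p: "0 < p" "p \<le> 4 * Y" using pos \<xi> Y by (auto simp: p_def field_simps)
  define k where "k = nat \<lceil>Y / p\<rceil>"
  have k: "Y / p \<le> real k" "real k < Y / p + 1"
    using Y p by (auto simp: k_def) linarith+
  define z where "z = pi / (2 * \<xi>) + p * real k"
  have "p * real k \<ge> Y" "p * real k < Y + p"
    using k p by (auto simp: field_simps)
  moreover have "pi / (2 * \<xi>) = p / 4" by (simp add: p_def)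
  ultimately have z: "Y < z" "z \<le> 6 * Y" using p by (auto simp: z_def)
  have "\<xi> * z = pi / 2 + 2 * pi * real k"
    using pos by (simp add: z_def p_def field_simps)
  then have "emeasure \<mu> {z<..} \<le> 2 * jump_part \<mu> \<xi>"
    using tail_le_jump_part[OF qu pos] z Y by auto
  moreover have "emeasure \<mu> {6 * Y<..} \<le> emeasure \<mu> {z<..}"
    using z by (intro emeasure_mono) auto
  ultimately show ?thesis by (rule order_trans[rotated])
qed

section \<open>Comparison of integrals over tails, and symmetry\<close>

text \<open>Layer-cake argument: each superlevel set of \<open>f\<close> in
  \<open>(Y, \<infinity>)\<close> is upward closed by monotonicity and open by continuity, so it is
  empty or an open half-line starting at or after \<open>Y\<close>, and there the two measures are
  ordered by assumption.\<close>

lemma nn_integral_tail_mono: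
  fixes \<mu>1 \<mu>2 :: "real measure" and f :: "real \<Rightarrow> real"
  assumes sets[measurable_cong]: "sets \<mu>1 = sets borel" "sets \<mu>2 = sets borel"
    and fin: "emeasure \<mu>1 {Y<..} < \<infinity>"
    and tails: "\<And>y. Y \<le> y \<Longrightarrow> emeasure \<mu>2 {y<..} \<le> emeasure \<mu>1 {y<..}"
    and f: "\<And>y. Y < y \<Longrightarrow> 0 \<le> f y" "mono_on {Y<..} f" "continuous_on UNIV f"
  shows "(\<integral>\<^sup>+y\<in>{Y<..}. ennreal (f y) \<partial>\<mu>2) \<le> (\<integral>\<^sup>+y\<in>{Y<..}. ennreal (f y) \<partial>\<mu>1)"
proof -
  have [measurable]: "f \<in> borel_measurable borel"
    using f(3) by (rule borel_measurable_continuous_onI)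
  have layer: "(\<integral>\<^sup>+y\<in>{Y<..}. ennreal (f y) \<partial>\<mu>) = (\<integral>\<^sup>+t\<in>{0..}. emeasure \<mu> {y. Y < y \<and> t < f y} \<partial>lborel)"
    if [measurable_cong]: "sets \<mu> = sets borel" and "emeasure \<mu> {Y<..} < \<infinity>" for \<mu>
  proof -
    \<comment> \<open>Restricting to \<open>(Y, \<infinity>)\<close> discards the possibly infinite
      mass near 0 and yields the finite measure on which Fubini is applied.\<close>
    let ?\<mu> = "density \<mu> (indicator {Y<..})"
    have [measurable_cong]: "sets ?\<mu> = sets borel" by (simp add: that)
    interpret finite_measure ?\<mu>
      using that by (intro finite_measureI) (auto simp: emeasure_density sets_eq_imp_space_eq[OF that(1)])
    interpret pair_sigma_finite ?\<mu> lborel ..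
    have "(\<integral>\<^sup>+y\<in>{Y<..}. ennreal (f y) \<partial>\<mu>) = (\<integral>\<^sup>+y. ennreal (f y) \<partial>?\<mu>)"
      by (subst nn_integral_density) (auto simp: mult.commute)
    also have "\<dots> = (\<integral>\<^sup>+y. (\<integral>\<^sup>+t. indicator {(y, t). 0 \<le> t \<and> t < f y} (y, t) \<partial>lborel) \<partial>?\<mu>)"
    proof (intro nn_integral_cong)
      fix y
      have "ennreal (f y) = emeasure lborel {0..<f y}"
        by (cases "0 \<le> f y") (auto simp: ennreal_neg)
      also have "\<dots> = (\<integral>\<^sup>+t. indicator {0..<f y} t \<partial>lborel)" by simp
      also have "\<dots> = (\<integral>\<^sup>+t. indicator {(y, t). 0 \<le> t \<and> t < f y} (y, t) \<partial>lborel)"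
        by (intro nn_integral_cong) (auto simp: indicator_def)
      finally show "ennreal (f y) = (\<integral>\<^sup>+t. indicator {(y, t). 0 \<le> t \<and> t < f y} (y, t) \<partial>lborel)" .
    qed
    also have "\<dots> = (\<integral>\<^sup>+t. (\<integral>\<^sup>+y. indicator {(y, t). 0 \<le> t \<and> t < f y} (y, t) \<partial>?\<mu>) \<partial>lborel)"
      by (rule Fubini'[symmetric]) measurable
    also have "\<dots> = (\<integral>\<^sup>+t\<in>{0..}. emeasure \<mu> {y. Y < y \<and> t < f y} \<partial>lborel)"
    proof (intro nn_integral_cong)
      fix t :: real
      have "(\<integral>\<^sup>+y. indicator {(y, t). 0 \<le> t \<and> t < f y} (y, t) \<partial>?\<mu>)
          = (\<integral>\<^sup>+y. indicator {0..} t * indicator {y. Y < y \<and> t < f y} y \<partial>\<mu>)"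
        by (subst nn_integral_density) (auto simp: indicator_def intro!: nn_integral_cong)
      also have "\<dots> = indicator {0..} t * emeasure \<mu> {y. Y < y \<and> t < f y}"
        by (rule nn_integral_cmult_indicator) measurable
      finally show "(\<integral>\<^sup>+y. indicator {(y, t). 0 \<le> t \<and> t < f y} (y, t) \<partial>?\<mu>)
          = emeasure \<mu> {y. Y < y \<and> t < f y} * indicator {0..} t" by (simp add: mult.commute)
    qed
    finally show ?thesis .
  qed
  have le: "emeasure \<mu>2 {y. Y < y \<and> t < f y} \<le> emeasure \<mu>1 {y. Y < y \<and> t < f y}" for t
  proof (cases "{y. Y < y \<and> t < f y} = {}")
    case False
    let ?S = "{y. Y < y \<and> t < f y}"
    define s where "s = Inf ?S"
    have bdd: "bdd_below ?S" by (auto intro!: bdd_belowI[of _ Y])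
    have "Y \<le> s" unfolding s_def using False by (intro cInf_greatest) auto
    have "open ?S"
      using f(3) by (auto intro!: open_Collect_conj open_Collect_less continuous_intros)
    \<comment> \<open>Openness excludes the infimum itself: with every point of the set, a slightly
      smaller one belongs to it too.\<close>
    have "?S = {s<..}"
    proof (intro set_eqI iffI)
      fix y assume y: "y \<in> ?S"
      obtain e where "e > 0" "ball y e \<subseteq> ?S"
        using \<open>open ?S\<close> y open_contains_ball by blast
      then have "y - e / 2 \<in> ?S" by (auto simp: subset_eq dist_real_def)
      then have "s \<le> y - e / 2" unfolding s_def by (intro cInf_lower bdd)
      then show "y \<in> {s<..}" using \<open>e > 0\<close> by auto
    next
      fix y assume "y \<in> {s<..}"
      then obtain x where "x \<in> ?S" "x < y"
        using cInf_less_iff[OF False bdd] by (auto simp: s_def)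
      then have "f x \<le> f y" by (intro mono_onD[OF f(2)]) auto
      then show "y \<in> ?S" using \<open>x \<in> ?S\<close> \<open>x < y\<close> by auto
    qed
    then show ?thesis using tails \<open>Y \<le> s\<close> by simp
  next
    case True
    then show ?thesis by (simp only: emeasure_empty)
  qed
  have "emeasure \<mu>2 {Y<..} < \<infinity>" using tails[of Y] fin by (auto intro: le_less_trans)
  then show ?thesis
    using fin by (simp add: layer sets) (intro nn_integral_mono mult_right_mono le, auto)
qed

lemma nn_integral_symmetric:
  assumes "symmetric_measure \<mu>" and [measurable]: "f \<in> borel_measurable borel"
  shows "(\<integral>\<^sup>+y. f (- y) \<partial>\<mu>) = (\<integral>\<^sup>+y. f y \<partial>\<mu>)"
proof -
  have [measurable_cong]: "sets \<mu> = sets borel"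
    using assms(1) by (simp add: symmetric_measure_def)
  have "distr \<mu> borel uminus = \<mu>"
  proof (rule measure_eqI)
    fix A assume "A \<in> sets (distr \<mu> borel uminus)"
    then have A: "A \<in> sets borel" by simp
    have "uminus -` A = uminus ` A" by force
    then show "emeasure (distr \<mu> borel uminus) A = emeasure \<mu> A"
      using assms(1) A by (simp add: emeasure_distr symmetric_measure_def sets_eq_imp_space_eq[OF \<open>sets \<mu> = sets borel\<close>])
  qed (simp add: \<open>sets \<mu> = sets borel\<close>)
  then have "(\<integral>\<^sup>+y. f y \<partial>\<mu>) = (\<integral>\<^sup>+y. f y \<partial>distr \<mu> borel uminus)" by simp
  also have "\<dots> = (\<integral>\<^sup>+y. f (- y) \<partial>\<mu>)" by (subst nn_integral_distr) auto
  finally show ?thesis ..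
qed

section \<open>Real symbols and their uniform bounds\<close>

text \<open>Drift and compensator are imaginary, so the real part keeps only the Gaussian term and
  \<open>1 - cos\<close>. A Bochner integral of a non-integrable function would be 0 by default, so
  integrability comes first: a second-order Taylor bound for \<open>\<bar>y\<bar> \<le> 1\<close>
  and the bound 2 for large jumps combine into a multiple of
  \<open>min 1 (y\<^sup>2)\<close>.\<close>

lemma ennreal_levy_symbol:
  assumes ker: "levy_kernel \<nu>" and "a x = 0" and "0 \<le> c x"
  shows "ennreal (Re (levy_symbol a b c \<nu> x \<xi>)) = ennreal (c x * \<xi>\<^sup>2 / 2) + jump_part (\<nu> x) \<xi>"
    and "0 \<le> Re (levy_symbol a b c \<nu> x \<xi>)"
proof -
  have [measurable_cong]: "sets (\<nu> x) = sets borel" and fin: "(\<integral>\<^sup>+y. ennreal (min 1 (y\<^sup>2)) \<partial>\<nu> x) < \<infinity>"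
    using ker by (auto simp: levy_kernel_def)
  let ?g = "\<lambda>y. exp (\<i> * of_real (\<xi> * y)) - 1 - \<i> * of_real (\<xi> * y * indicator {-1..1} y)"
  have "integrable (\<nu> x) (\<lambda>y. min 1 (y\<^sup>2))"
    using fin by (intro integrableI_bounded) auto
  then have "integrable (\<nu> x) (\<lambda>y. (\<xi>\<^sup>2 / 2 + 2) * min 1 (y\<^sup>2))"
    by simp
  then have int: "integrable (\<nu> x) ?g"
  proof (rule Bochner_Integration.integrable_bound)
    show "?g \<in> borel_measurable (\<nu> x)" by measurable
    have "norm (?g y) \<le> (\<xi>\<^sup>2 / 2 + 2) * min 1 (y\<^sup>2)" for y
    proof (cases "\<bar>y\<bar> \<le> 1")
      case True
      then have "indicator {-1..1} y = (1 :: real)" by (auto simp: indicator_def)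
      then have "norm (?g y) \<le> (\<xi> * y)\<^sup>2 / 2"
        using iexp_approx1[of "\<xi> * y" 1] by (auto simp: numeral_2_eq_2 algebra_simps)
      also have "\<dots> \<le> (\<xi>\<^sup>2 / 2 + 2) * y\<^sup>2"
        by (simp add: power_mult_distrib algebra_simps)
      also have "y\<^sup>2 = min 1 (y\<^sup>2)" using True by (simp add: min_def abs_square_le_1 order_antisym)
      finally show ?thesis .
    next
      case False
      then have "norm (?g y) \<le> norm (exp (\<i> * of_real (\<xi> * y))) + norm (1 :: complex)"
        using norm_triangle_ineq4[of "exp (\<i> * of_real (\<xi> * y))" 1] by (auto simp: indicator_def)
      also have "\<dots> \<le> \<xi>\<^sup>2 / 2 + 2" by simp
      also have "\<dots> = (\<xi>\<^sup>2 / 2 + 2) * min 1 (y\<^sup>2)"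
        using False abs_square_le_1[of y] by simp
      finally show ?thesis .
    qed
    then show "AE y in \<nu> x. norm (?g y) \<le> norm ((\<xi>\<^sup>2 / 2 + 2) * min 1 (y\<^sup>2))"
      by (auto simp: abs_mult intro: order_trans)
  qed
  have Re: "Re (?g y) = - (1 - cos (\<xi> * y))" for y
    by (simp add: Re_exp)
  have int': "integrable (\<nu> x) (\<lambda>y. 1 - cos (\<xi> * y))"
    using integrable_minus[OF integrable_Re[OF int]] unfolding Re by simp
  have "Re (\<integral>y. ?g y \<partial>\<nu> x) = - (\<integral>y. 1 - cos (\<xi> * y) \<partial>\<nu> x)"
    unfolding integral_Re[OF int, symmetric] Re by (rule Bochner_Integration.integral_minus)
  then have eq: "Re (levy_symbol a b c \<nu> x \<xi>) = c x * \<xi>\<^sup>2 / 2 + (\<integral>y. 1 - cos (\<xi> * y) \<partial>\<nu> x)"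
    using assms(2) by (simp add: levy_symbol_def)
  have nn: "0 \<le> (\<integral>y. 1 - cos (\<xi> * y) \<partial>\<nu> x)" by (intro integral_nonneg_AE) auto
  show "0 \<le> Re (levy_symbol a b c \<nu> x \<xi>)" using assms nn by (simp add: eq)
  show "ennreal (Re (levy_symbol a b c \<nu> x \<xi>)) = ennreal (c x * \<xi>\<^sup>2 / 2) + jump_part (\<nu> x) \<xi>"
    using assms nn int' by (simp add: eq jump_part_def nn_integral_eq_integral)
qed

context symmetric_nice_feller_process
begin

abbreviation symbol :: "real \<Rightarrow> real \<Rightarrow> real" where
  "symbol x \<xi> \<equiv> Re (levy_symbol a b c \<nu> x \<xi>)"

lemma sets_levy [measurable_cong]: "sets (\<nu> x) = sets borel"
  using levy by (simp add: levy_kernel_def)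

lemma ennreal_symbol: "ennreal (symbol x \<xi>) = ennreal (c x * \<xi>\<^sup>2 / 2) + jump_part (\<nu> x) \<xi>"
  and symbol_nonneg: "0 \<le> symbol x \<xi>"
  using ennreal_levy_symbol[OF levy, of a x c b \<xi>] C3 nonneg_coeffs by auto

lemma jump_part_le_symbol: "jump_part (\<nu> x) \<bar>\<xi>\<bar> \<le> ennreal (symbol x \<xi>)"
proof -
  have "cos (\<bar>\<xi>\<bar> * y) = cos (\<xi> * y)" for y by (cases "0 \<le> \<xi>") auto
  then show ?thesis by (simp add: ennreal_symbol jump_part_def)
qed

text \<open>Small jumps are controlled by the symbol at the single frequency \<open>\<eta>\<close>:
  for \<open>\<bar>y\<bar> \<le> Y\<close> the phase \<open>\<eta> * y\<close> stays within
  \<open>pi / 2\<close>, so \<open>1 - cos (\<eta> * y)\<close> is comparable to its square, and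
  rescaling the frequency produces the factor \<open>(\<xi> / \<eta>)\<^sup>2\<close>. No second
  moment of the small jumps has to be estimated.\<close>

lemma symbol_le_local_plus_tail:
  assumes Y: "0 < Y" and \<eta>: "\<eta> = pi / (2 * Y)"
  shows "ennreal (symbol x \<xi>) \<le> ennreal (2 * (\<xi> / \<eta>)\<^sup>2 * symbol x \<eta>)
    + 4 * (\<integral>\<^sup>+y\<in>{Y<..}. ennreal (min 1 ((\<xi> * y)\<^sup>2)) \<partial>\<nu> x)"
proof -
  define K where "K = 2 * (\<xi> / \<eta>)\<^sup>2"
  have "0 < \<eta>" using Y by (simp add: \<eta>)
  have "0 \<le> K" by (simp add: K_def)
  let ?g = "\<lambda>y. ennreal (min 1 ((\<xi> * y)\<^sup>2)) * indicator {Y<..} y"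
  have bound: "ennreal (1 - cos (\<xi> * y)) \<le> ennreal K * ennreal (1 - cos (\<eta> * y)) + (2 * ?g y + 2 * ?g (- y))" for y
  proof (cases "\<bar>y\<bar> \<le> Y")
    case True
    then have "\<bar>\<eta> * y\<bar> \<le> pi / 2"
      using Y by (simp add: \<eta> abs_mult field_simps)
    then have "(\<xi> / \<eta>)\<^sup>2 * (\<eta> * y)\<^sup>2 \<le> (\<xi> / \<eta>)\<^sup>2 * (4 * (1 - cos (\<eta> * y)))"
      by (intro mult_left_mono square_le_one_minus_cos) auto
    moreover have "(\<xi> / \<eta>)\<^sup>2 * (\<eta> * y)\<^sup>2 = (\<xi> * y)\<^sup>2"
      using \<open>0 < \<eta>\<close> by (simp add: power_mult_distrib power_divide)
    moreover have "(\<xi> / \<eta>)\<^sup>2 * (4 * (1 - cos (\<eta> * y))) = 2 * (K * (1 - cos (\<eta> * y)))"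
      by (simp add: K_def)
    ultimately have "1 - cos (\<xi> * y) \<le> K * (1 - cos (\<eta> * y))"
      using one_minus_cos_le[of "\<xi> * y"] by linarith
    then have "ennreal (1 - cos (\<xi> * y)) \<le> ennreal K * ennreal (1 - cos (\<eta> * y))"
      using \<open>0 \<le> K\<close> by (subst ennreal_mult[symmetric]) (auto simp: ennreal_leI)
    then show ?thesis by (rule order_trans) simp
  next
    case False
    \<comment> \<open>This factor 2 and the folding of the negative tail onto the positive one by
      symmetry give the 4 in the statement.\<close>
    have "1 - cos (\<xi> * y) \<le> 2 * min 1 ((\<xi> * y)\<^sup>2)"
      using one_minus_cos_le[of "\<xi> * y"] cos_ge_minus_one[of "\<xi> * y"] zero_le_power2[of "\<xi> * y"]
      by linarith
    then have "ennreal (1 - cos (\<xi> * y)) \<le> ennreal (2 * min 1 ((\<xi> * y)\<^sup>2))"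
      by (rule ennreal_leI)
    also have "\<dots> = 2 * ennreal (min 1 ((\<xi> * y)\<^sup>2))"
      by (subst ennreal_mult) auto
    also have "\<dots> \<le> 2 * ?g y + 2 * ?g (- y)"
      using False by (cases "0 \<le> y") (auto simp: indicator_def)
    finally show ?thesis by (rule order_trans) simp
  qed
  have "jump_part (\<nu> x) \<xi> \<le> (\<integral>\<^sup>+y. ennreal K * ennreal (1 - cos (\<eta> * y)) + (2 * ?g y + 2 * ?g (- y)) \<partial>\<nu> x)"
    unfolding jump_part_def by (intro nn_integral_mono bound)
  also have "\<dots> = ennreal K * jump_part (\<nu> x) \<eta> + (2 * (\<integral>\<^sup>+y. ?g y \<partial>\<nu> x) + 2 * (\<integral>\<^sup>+y. ?g (- y) \<partial>\<nu> x))"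
    unfolding jump_part_def by (simp add: nn_integral_add nn_integral_cmult)
  also have "(\<integral>\<^sup>+y. ?g (- y) \<partial>\<nu> x) = (\<integral>\<^sup>+y. ?g y \<partial>\<nu> x)"
    by (rule nn_integral_symmetric[OF symmetric_levy]) measurable
  also have "2 * (\<integral>\<^sup>+y. ?g y \<partial>\<nu> x) + 2 * (\<integral>\<^sup>+y. ?g y \<partial>\<nu> x) = 4 * (\<integral>\<^sup>+y. ?g y \<partial>\<nu> x)"
    by (simp flip: distrib_right)
  finally have jump: "jump_part (\<nu> x) \<xi> \<le> ennreal K * jump_part (\<nu> x) \<eta> + 4 * (\<integral>\<^sup>+y. ?g y \<partial>\<nu> x)" .
  \<comment> \<open>The Gaussian term scales by exactly \<open>(\<xi> / \<eta>)\<^sup>2\<close>, so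
    it fits under the same \<open>K\<close>.\<close>
  have "c x * \<xi>\<^sup>2 / 2 \<le> K * (c x * \<eta>\<^sup>2 / 2)"
    using \<open>0 < \<eta>\<close> nonneg_coeffs(2)[of x] by (simp add: K_def power_divide)
  then have "ennreal (c x * \<xi>\<^sup>2 / 2) \<le> ennreal K * ennreal (c x * \<eta>\<^sup>2 / 2)"
    using \<open>0 \<le> K\<close> nonneg_coeffs(2)[of x] by (subst ennreal_mult[symmetric]) (auto simp: ennreal_leI)
  then have "ennreal (symbol x \<xi>) \<le> ennreal K * ennreal (c x * \<eta>\<^sup>2 / 2)
      + (ennreal K * jump_part (\<nu> x) \<eta> + 4 * (\<integral>\<^sup>+y. ?g y \<partial>\<nu> x))"
    unfolding ennreal_symbol by (intro add_mono jump)
  also have "\<dots> = ennreal K * ennreal (symbol x \<eta>) + 4 * (\<integral>\<^sup>+y. ?g y \<partial>\<nu> x)"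
    by (simp add: ennreal_symbol distrib_left add.assoc)
  also have "ennreal K * ennreal (symbol x \<eta>) = ennreal (K * symbol x \<eta>)"
    using \<open>0 \<le> K\<close> symbol_nonneg by (simp add: ennreal_mult)
  finally show ?thesis by (simp add: K_def)
qed

text \<open>Condition (C2) at the fixed frequency \<open>pi / (2 * Y)\<close> makes the local term
  quadratic in \<open>\<xi>\<close> uniformly in \<open>x\<close>. Away from 0, (C2) alone gives a
  quadratic bound; that second estimate serves the frequencies beyond the reach of
  \<open>truncated_square_le_jump_part\<close>.\<close>

lemma symbol_le_square_plus_tail:
  assumes Y: "0 < Y"
  shows "\<exists>B\<ge>0. (\<forall>x \<xi>. ennreal (symbol x \<xi>)
            \<le> ennreal (B * \<xi>\<^sup>2) + 4 * (\<integral>\<^sup>+y\<in>{Y<..}. ennreal (min 1 ((\<xi> * y)\<^sup>2)) \<partial>\<nu> x)) \<and>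
    (\<forall>x \<xi>. pi / (2 * Y) \<le> \<bar>\<xi>\<bar> \<longrightarrow> symbol x \<xi> \<le> B * \<xi>\<^sup>2)"
proof -
  define \<eta> where "\<eta> = pi / (2 * Y)"
  have "0 < \<eta>" using Y by (simp add: \<eta>_def)
  obtain C where C: "0 \<le> C" "\<And>x \<xi>. norm (levy_symbol a b c \<nu> x \<xi>) \<le> C * (1 + \<xi>\<^sup>2)"
    using C2 by blast
  have sC: "symbol x \<xi> \<le> C * (1 + \<xi>\<^sup>2)" for x \<xi>
    using C(2)[of x \<xi>] complex_Re_le_cmod order_trans by blast
  define B where "B = 2 * C * (1 + \<eta>\<^sup>2) / \<eta>\<^sup>2"
  have "0 \<le> B" using C by (simp add: B_def)
  have global: "ennreal (symbol x \<xi>) \<le> ennreal (B * \<xi>\<^sup>2)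
      + 4 * (\<integral>\<^sup>+y\<in>{Y<..}. ennreal (min 1 ((\<xi> * y)\<^sup>2)) \<partial>\<nu> x)" for x \<xi>
  proof -
    have "2 * (\<xi> / \<eta>)\<^sup>2 * symbol x \<eta> \<le> 2 * (\<xi> / \<eta>)\<^sup>2 * (C * (1 + \<eta>\<^sup>2))"
      by (intro mult_left_mono sC) auto
    also have "\<dots> = B * \<xi>\<^sup>2" by (simp add: B_def power_divide)
    finally show ?thesis
      by (intro order_trans[OF symbol_le_local_plus_tail[OF Y \<eta>_def]] add_right_mono ennreal_leI)
  qed
  have away: "symbol x \<xi> \<le> B * \<xi>\<^sup>2" if "pi / (2 * Y) \<le> \<bar>\<xi>\<bar>" for x \<xi>
  proof -
    have "\<eta>\<^sup>2 \<le> \<xi>\<^sup>2"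
      using that \<open>0 < \<eta>\<close> by (simp add: \<eta>_def abs_le_square_iff[symmetric])
    then have "C * \<eta>\<^sup>2 * (1 + \<xi>\<^sup>2) \<le> C * 2 * (1 + \<eta>\<^sup>2) * \<xi>\<^sup>2"
      unfolding mult.assoc using C(1) by (intro mult_left_mono) (auto simp: algebra_simps intro: order_trans)
    then have "C * (1 + \<xi>\<^sup>2) \<le> B * \<xi>\<^sup>2"
      using \<open>0 < \<eta>\<close> by (simp add: B_def field_simps)
    then show ?thesis using sC order_trans by blast
  qed
  show ?thesis
    by (intro exI[of _ B] conjI allI impI global away \<open>0 \<le> B\<close>)
qed

end

section \<open>Integrals of reciprocals\<close>

lemma ennreal_inverse_antimono:
  fixes u v :: ennreal
  assumes "u \<le> v"
  shows "inverse v \<le> inverse u"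
proof (cases "u = 0 \<or> v = top")
  case False
  then obtain p q where "0 \<le> p" "u = ennreal p" "0 \<le> q" "v = ennreal q"
    using assms by (metis ennreal_cases top_unique)
  with False assms show ?thesis
    by (auto simp: inverse_ennreal order.strict_iff_order intro!: ennreal_leI le_imp_inverse_le)
qed auto

text \<open>No measurability is available for suprema and infima over uncountably many states, so
  the constant is moved through the simple functions below the integrand.\<close>

lemma nn_integral_mono_cmult:
  fixes f g :: "'a \<Rightarrow> ennreal"
  assumes "0 < L" "\<And>x. f x \<le> ennreal L * g x"
  shows "(\<integral>\<^sup>+x. f x \<partial>M) \<le> ennreal L * (\<integral>\<^sup>+x. g x \<partial>M)"
  unfolding nn_integral_def[of M f]
proof (intro SUP_least, safe)
  fix s assume s: "simple_function M s" "s \<le> f"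
  let ?s = "\<lambda>x. ennreal (1 / L) * s x"
  have L: "ennreal L * ennreal (1 / L) = 1"
    using assms(1) by (subst ennreal_mult[symmetric]) auto
  have "?s x \<le> g x" for x
  proof -
    have "?s x \<le> ennreal (1 / L) * (ennreal L * g x)"
      using s(2) assms(2) by (intro mult_left_mono) (auto simp: le_fun_def intro: order_trans)
    then show ?thesis using L by (simp add: mult.assoc[symmetric] mult.commute)
  qed
  then have "integral\<^sup>S M ?s \<le> (\<integral>\<^sup>+x. g x \<partial>M)"
    unfolding nn_integral_def using s(1) by (intro SUP_upper) (auto simp: le_fun_def)
  moreover have "integral\<^sup>S M ?s = ennreal (1 / L) * integral\<^sup>S M s"
    using s(1) by (rule simple_integral_mult)
  ultimately have "ennreal L * (ennreal (1 / L) * integral\<^sup>S M s) \<le> ennreal L * (\<integral>\<^sup>+x. g x \<partial>M)"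
    by (intro mult_left_mono) auto
  then show "integral\<^sup>S M s \<le> ennreal L * (\<integral>\<^sup>+x. g x \<partial>M)"
    using L by (simp add: mult.assoc[symmetric])
qed

text \<open>Turns pointwise domination of symbols into a comparison of the integrals in the theorem.
  The constant \<open>L\<close> is positive and finite, so it passes through the inverse even where
  \<open>v\<close> is 0 or infinite, consistently with \<open>1 / 0 = \<infinity>\<close>.\<close>

lemma nn_integral_reciprocal_le:
  fixes u v :: "'a \<Rightarrow> ennreal"
  assumes "0 < L" "\<And>\<xi>. \<xi> \<in> A \<Longrightarrow> u \<xi> \<le> ennreal L * v \<xi>"
  shows "(\<integral>\<^sup>+\<xi>\<in>A. 1 / v \<xi> \<partial>M) \<le> ennreal L * (\<integral>\<^sup>+\<xi>\<in>A. 1 / u \<xi> \<partial>M)"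
proof (rule nn_integral_mono_cmult[OF assms(1)])
  fix \<xi>
  show "1 / v \<xi> * indicator A \<xi> \<le> ennreal L * (1 / u \<xi> * indicator A \<xi>)"
  proof (cases "\<xi> \<in> A")
    case True
    have L: "ennreal L * inverse (ennreal L) = 1"
      using assms(1) by (simp add: inverse_ennreal ennreal_mult[symmetric])
    have "inverse (v \<xi>) = ennreal L * inverse (ennreal L * v \<xi>)"
      using assms(1) L by (subst ennreal_inverse_mult') (auto simp: mult.assoc[symmetric])
    also have "\<dots> \<le> ennreal L * inverse (u \<xi>)"
      using assms(2)[OF True] by (intro mult_left_mono ennreal_inverse_antimono) auto
    finally show ?thesis using True by (simp add: divide_ennreal_def)
  qed simp
qed

text \<open>On \<open>(0, s)\<close> the integrand is at least its value at \<open>s\<close>, so the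
  integral is at least \<open>1 / (B * s)\<close>, which is unbounded as \<open>s\<close> tends to
  0.\<close>

lemma nn_integral_inverse_square_eq_infinity:
  assumes "0 < B" "0 < r"
  shows "(\<integral>\<^sup>+\<xi>\<in>{\<xi>::real. \<bar>\<xi>\<bar> < r}. 1 / ennreal (B * \<xi>\<^sup>2) \<partial>lborel) = \<infinity>" (is "?I = _")
proof -
  have lower: "ennreal (1 / (B * s)) \<le> ?I" if "0 < s" "s < r" for s
  proof -
    have "ennreal (1 / (B * s)) = ennreal (1 / (B * s\<^sup>2)) * emeasure lborel {0<..<s}"
      using that assms by (simp add: ennreal_mult[symmetric] power2_eq_square)
    also have "\<dots> = (\<integral>\<^sup>+\<xi>. ennreal (1 / (B * s\<^sup>2)) * indicator {0<..<s} \<xi> \<partial>lborel)"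
      by (simp add: nn_integral_cmult_indicator)
    also have "\<dots> \<le> ?I"
    proof (intro nn_integral_mono)
      fix \<xi> :: real
      show "ennreal (1 / (B * s\<^sup>2)) * indicator {0<..<s} \<xi>
          \<le> 1 / ennreal (B * \<xi>\<^sup>2) * indicator {\<xi>. \<bar>\<xi>\<bar> < r} \<xi>"
      proof (cases "\<xi> \<in> {0<..<s}")
        case True
        then have "\<xi>\<^sup>2 \<le> s\<^sup>2" by (intro power_mono) auto
        then have "1 / (B * s\<^sup>2) \<le> 1 / (B * \<xi>\<^sup>2)"
          using True assms by (intro divide_left_mono mult_left_mono) auto
        then have "ennreal (1 / (B * s\<^sup>2)) \<le> ennreal (1 / (B * \<xi>\<^sup>2))"
          by (rule ennreal_leI)
        also have "ennreal (1 / (B * \<xi>\<^sup>2)) = 1 / ennreal (B * \<xi>\<^sup>2)"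
          using True assms divide_ennreal[of 1 "B * \<xi>\<^sup>2"] by simp
        finally show ?thesis using True that by (simp add: indicator_def)
      qed simp
    qed
    finally show ?thesis .
  qed
  have big: "ennreal v \<le> ?I" if "0 < v" for v
  proof -
    define s where "s = min (r / 2) (1 / (B * v))"
    have s: "0 < s" "s < r" using that assms by (auto simp: s_def)
    have "s \<le> 1 / (B * v)" by (simp add: s_def)
    then have "v \<le> 1 / (B * s)" using s that assms by (simp add: field_simps)
    then show ?thesis using lower[OF s] by (meson ennreal_leI order_trans)
  qed
  show ?thesis
  proof (rule ccontr)
    assume "?I \<noteq> \<infinity>"
    then obtain v where v: "0 \<le> v" "?I = ennreal v" by (cases ?I) auto
    then have "ennreal (v + 1) \<le> ennreal v" using big[of "v + 1"] by simp
    then show False using v(1) by simp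
  qed
qed

section \<open>Uniform comparison of the two symbols\<close>

text \<open>The two processes are compared here once for both implications. The final disjunction is
  what removes the quadratic term in the first implication, where no growth of \<open>q1\<close>
  near 0 is assumed.\<close>

lemma symbol_comparison:
  assumes process1: "symmetric_nice_feller_process M1 P1 F1 a1 b1 c1 \<nu>1"
    and process2: "symmetric_nice_feller_process M2 P2 F2 a2 b2 c2 \<nu>2"
    and unimodal: "uniformly_quasi_unimodal \<nu>1"
    and tails: "\<exists>y1>0. \<forall>x. \<forall>y\<ge>y1. emeasure (\<nu>1 x) {y<..} \<ge> emeasure (\<nu>2 x) {y<..}"
  defines "q1 \<equiv> \<lambda>x \<xi>. Re (levy_symbol a1 b1 c1 \<nu>1 x \<xi>)"
    and "q2 \<equiv> \<lambda>x \<xi>. Re (levy_symbol a2 b2 c2 \<nu>2 x \<xi>)"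
  obtains B K where "0 \<le> B" "0 \<le> K" "\<And>x \<xi>. q2 x \<xi> \<le> B * \<xi>\<^sup>2 + K * q1 x \<xi>"
    and "(\<forall>x \<xi>. q2 x \<xi> \<le> B * \<xi>\<^sup>2) \<or> (\<exists>x. \<exists>\<delta>>0. \<forall>\<xi>. \<delta> * min 1 (\<xi>\<^sup>2) \<le> q1 x \<xi>)"
proof -
  interpret p1: symmetric_nice_feller_process M1 P1 F1 a1 b1 c1 \<nu>1 by fact
  interpret p2: symmetric_nice_feller_process M2 P2 F2 a2 b2 c2 \<nu>2 by fact
  obtain y0 where y0: "0 \<le> y0" "\<And>x. quasi_unimodal_from y0 (\<nu>1 x)"
    using unimodal by (auto simp: uniformly_quasi_unimodal_def)
  obtain y1 where y1: "0 < y1" "\<And>x y. y1 \<le> y \<Longrightarrow> emeasure (\<nu>2 x) {y<..} \<le> emeasure (\<nu>1 x) {y<..}"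
    using tails by blast
  \<comment> \<open>Beyond \<open>Y\<close> the tail of \<open>\<nu>1\<close> is finite and convex
    and dominates that of \<open>\<nu>2\<close>; the summand 1 ensures
    \<open>1 \<le> y\<^sup>2\<close> there.\<close>
  define Y where "Y = 1 + y0 + y1"
  have Y: "1 \<le> Y" "y0 < Y" "0 < Y" "y1 \<le> Y" using y0 y1 by (auto simp: Y_def)
  define \<eta> where "\<eta> = pi / (2 * Y)"
  have \<eta>: "0 < \<eta>" using Y by (simp add: \<eta>_def)
  have fin: "emeasure (\<nu>1 x) {y<..} < \<infinity>" if "y0 < y" for x y
    using y0(2)[of x] that by (auto simp: quasi_unimodal_from_def)
  let ?m = "\<lambda>\<xi> y. min 1 ((\<xi> * y)\<^sup>2) :: real"
  have tail1: "(\<integral>\<^sup>+y\<in>{Y<..}. ennreal (?m \<xi> y) \<partial>\<nu>1 x) \<le> ennreal (6 * q1 x \<xi>)"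
    if "\<bar>\<xi>\<bar> < \<eta>" "\<xi> \<noteq> 0" for x \<xi>
  proof -
    have "(\<integral>\<^sup>+y\<in>{Y<..}. ennreal (?m \<bar>\<xi>\<bar> y) \<partial>\<nu>1 x) \<le> 6 * jump_part (\<nu>1 x) \<bar>\<xi>\<bar>"
      using that Y by (intro truncated_square_le_jump_part[OF y0(2)]) (auto simp: \<eta>_def)
    also have "\<dots> \<le> 6 * ennreal (q1 x \<xi>)"
      unfolding q1_def by (intro mult_left_mono p1.jump_part_le_symbol) auto
    finally show ?thesis
      by (simp add: ennreal_mult q1_def p1.symbol_nonneg power_mult_distrib)
  qed
  have tail2: "(\<integral>\<^sup>+y\<in>{Y<..}. ennreal (?m \<xi> y) \<partial>\<nu>2 x) \<le> (\<integral>\<^sup>+y\<in>{Y<..}. ennreal (?m \<xi> y) \<partial>\<nu>1 x)" for x \<xi>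
  proof (rule nn_integral_tail_mono[OF p1.sets_levy p2.sets_levy])
    show "emeasure (\<nu>1 x) {Y<..} < \<infinity>" using fin Y by auto
    show "emeasure (\<nu>2 x) {y<..} \<le> emeasure (\<nu>1 x) {y<..}" if "Y \<le> y" for y
      using y1(2) that Y by auto
    show "mono_on {Y<..} (?m \<xi>)"
      using Y by (intro mono_onI min.mono) (auto simp: power_mult_distrib intro!: mult_left_mono power_mono)
  qed (auto intro!: continuous_intros)
  obtain B1 where B1: "0 \<le> B1"
    "\<And>x \<xi>. ennreal (q2 x \<xi>) \<le> ennreal (B1 * \<xi>\<^sup>2) + 4 * (\<integral>\<^sup>+y\<in>{Y<..}. ennreal (?m \<xi> y) \<partial>\<nu>2 x)"
    "\<And>x \<xi>. \<eta> \<le> \<bar>\<xi>\<bar> \<Longrightarrow> q2 x \<xi> \<le> B1 * \<xi>\<^sup>2"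
    using p2.symbol_le_square_plus_tail[OF Y(3)] unfolding q2_def \<eta>_def by blast
  have "0 < 6 * Y" using Y by simp
  \<comment> \<open>A second splitting at \<open>6 * Y\<close>, the point from which
    \<open>far_tail_le_jump_part\<close> controls the tail; the dichotomy asks whether anything lies
    beyond it.\<close>
  obtain B2 where B2: "0 \<le> B2"
    "\<And>x \<xi>. ennreal (q2 x \<xi>) \<le> ennreal (B2 * \<xi>\<^sup>2) + 4 * (\<integral>\<^sup>+y\<in>{6 * Y<..}. ennreal (?m \<xi> y) \<partial>\<nu>2 x)"
    using p2.symbol_le_square_plus_tail[OF \<open>0 < 6 * Y\<close>] unfolding q2_def by blast
  have q1_nonneg: "0 \<le> q1 x \<xi>" for x \<xi> by (simp add: q1_def p1.symbol_nonneg)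
  have compare: "q2 x \<xi> \<le> B1 * \<xi>\<^sup>2 + 24 * q1 x \<xi>" for x \<xi>
  proof -
    consider "\<xi> = 0" | "\<eta> \<le> \<bar>\<xi>\<bar>" | "\<xi> \<noteq> 0" "\<bar>\<xi>\<bar> < \<eta>" by linarith
    then show ?thesis
    proof cases
      case 1
      then show ?thesis using p2.C3[of x] q1_nonneg[of x 0] by (simp add: q2_def)
    next
      case 2
      then show ?thesis using B1(3) q1_nonneg[of x \<xi>] by (simp add: add_increasing2)
    next
      case 3
      \<comment> \<open>Replace the tail integral of \<open>\<nu>2\<close> by that of
        \<open>\<nu>1\<close>, then bound it by \<open>6 * q1 x \<xi>\<close>; with the 4 from the
        splitting this gives 24.\<close>
      have "ennreal (q2 x \<xi>) \<le> ennreal (B1 * \<xi>\<^sup>2) + 4 * ennreal (6 * q1 x \<xi>)"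
        by (intro order_trans[OF B1(2)] add_left_mono mult_left_mono order_trans[OF tail2 tail1[OF 3(2,1)]]) simp
      also have "\<dots> = ennreal (B1 * \<xi>\<^sup>2 + 24 * q1 x \<xi>)"
      proof -
        have "4 * ennreal (6 * q1 x \<xi>) = ennreal (4 * (6 * q1 x \<xi>))"
          using q1_nonneg[of x \<xi>] by (subst ennreal_mult) auto
        then show ?thesis using B1(1) q1_nonneg[of x \<xi>] by simp
      qed
      finally show ?thesis
        using B1(1) q1_nonneg[of x \<xi>] by (subst (asm) ennreal_le_iff) auto
    qed
  qed
  have dichotomy: "(\<forall>x \<xi>. q2 x \<xi> \<le> B2 * \<xi>\<^sup>2) \<or> (\<exists>x. \<exists>\<delta>>0. \<forall>\<xi>. \<delta> * min 1 (\<xi>\<^sup>2) \<le> q1 x \<xi>)"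
  proof (cases "\<forall>x. emeasure (\<nu>1 x) {6 * Y<..} = 0")
    case True
    have "q2 x \<xi> \<le> B2 * \<xi>\<^sup>2" for x \<xi>
    proof -
      have "(\<integral>\<^sup>+y\<in>{6 * Y<..}. ennreal (?m \<xi> y) \<partial>\<nu>2 x) \<le> (\<integral>\<^sup>+y. indicator {6 * Y<..} y \<partial>\<nu>2 x)"
        by (intro nn_integral_mono) (auto simp: indicator_def ennreal_le_1)
      also have "\<dots> = emeasure (\<nu>2 x) {6 * Y<..}" by simp
      also have "\<dots> \<le> 0" using y1(2)[of "6 * Y" x] Y True by simp
      finally have "ennreal (q2 x \<xi>) \<le> ennreal (B2 * \<xi>\<^sup>2)"
        using B2(2)[of x \<xi>] by simp
      then show ?thesis using B2(1) by (subst (asm) ennreal_le_iff) auto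
    qed
    then show ?thesis by blast
  next
    case False
    then obtain x where x: "emeasure (\<nu>1 x) {6 * Y<..} \<noteq> 0" by blast
    define m where "m = measure (\<nu>1 x) {6 * Y<..}"
    have m: "emeasure (\<nu>1 x) {6 * Y<..} = ennreal m"
      using fin[of "6 * Y" x] Y by (auto simp: m_def intro!: emeasure_eq_ennreal_measure)
    with x have "0 < m" by (simp add: m_def zero_less_measure_iff measure_nonneg order.strict_iff_order)
    \<comment> \<open>High frequencies give the stronger bound \<open>m / 2\<close> from the far
      tail. At low frequencies every jump beyond \<open>6 * Y\<close> contributes at least
      \<open>min 1 (\<xi>\<^sup>2)\<close> to the truncated integral, and the constant 6 of
      \<open>tail1\<close> determines \<open>m / 6\<close>.\<close>
    have "m / 6 * min 1 (\<xi>\<^sup>2) \<le> q1 x \<xi>" for \<xi>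
    proof -
      consider "\<xi> = 0" | "\<eta> \<le> \<bar>\<xi>\<bar>" | "\<xi> \<noteq> 0" "\<bar>\<xi>\<bar> < \<eta>" by linarith
      then show ?thesis
      proof cases
        case 1
        then show ?thesis using q1_nonneg by simp
      next
        case 2
        have "ennreal m \<le> 2 * jump_part (\<nu>1 x) \<bar>\<xi>\<bar>"
          using 2 Y far_tail_le_jump_part[OF y0(2), of Y "\<bar>\<xi>\<bar>" x] by (simp add: m \<eta>_def)
        also have "\<dots> \<le> 2 * ennreal (q1 x \<xi>)"
          unfolding q1_def by (intro mult_left_mono p1.jump_part_le_symbol) auto
        also have "\<dots> = ennreal (2 * q1 x \<xi>)"
          using q1_nonneg[of x \<xi>] by (subst ennreal_mult) auto
        finally have "m \<le> 2 * q1 x \<xi>"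
          using q1_nonneg[of x \<xi>] by (subst (asm) ennreal_le_iff) auto
        moreover have "m / 6 * min 1 (\<xi>\<^sup>2) \<le> m / 6 * 1"
          using \<open>0 < m\<close> by (intro mult_left_mono) auto
        ultimately show ?thesis using \<open>0 < m\<close> by linarith
      next
        case 3
        have "ennreal (min 1 (\<xi>\<^sup>2) * m) = (\<integral>\<^sup>+y. ennreal (min 1 (\<xi>\<^sup>2)) * indicator {6 * Y<..} y \<partial>\<nu>1 x)"
          using \<open>0 < m\<close> by (simp add: nn_integral_cmult_indicator m ennreal_mult)
        also have "\<dots> \<le> (\<integral>\<^sup>+y\<in>{Y<..}. ennreal (?m \<xi> y) \<partial>\<nu>1 x)"
        proof (intro nn_integral_mono)
          fix y
          show "ennreal (min 1 (\<xi>\<^sup>2)) * indicator {6 * Y<..} y \<le> ennreal (?m \<xi> y) * indicator {Y<..} y"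
          proof (cases "6 * Y < y")
            case True
            then have "1 \<le> y\<^sup>2" using Y by (intro one_le_power) auto
            then have "\<xi>\<^sup>2 * 1 \<le> (\<xi> * y)\<^sup>2"
              unfolding power_mult_distrib by (intro mult_left_mono) auto
            then show ?thesis using True Y by (auto intro!: ennreal_leI min.mono)
          qed simp
        qed
        also have "\<dots> \<le> ennreal (6 * q1 x \<xi>)" using 3 by (intro tail1)
        finally have "min 1 (\<xi>\<^sup>2) * m \<le> 6 * q1 x \<xi>"
          using q1_nonneg[of x \<xi>] by (subst (asm) ennreal_le_iff) auto
        then show ?thesis by (simp add: mult.commute)
      qed
    qed
    then show ?thesis using \<open>0 < m\<close> by (intro disjI2 exI[of _ x] exI[of _ "m / 6"]) auto
  qed
  have B: "B1 * \<xi>\<^sup>2 \<le> (B1 + B2) * \<xi>\<^sup>2" "B2 * \<xi>\<^sup>2 \<le> (B1 + B2) * \<xi>\<^sup>2" for \<xi>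
    using B1(1) B2(1) by (auto intro!: mult_right_mono)
  show thesis
  proof (rule that[of "B1 + B2" 24])
    show "q2 x \<xi> \<le> (B1 + B2) * \<xi>\<^sup>2 + 24 * q1 x \<xi>" for x \<xi>
      using compare[of x \<xi>] B(1)[of \<xi>] by linarith
    show "(\<forall>x \<xi>. q2 x \<xi> \<le> (B1 + B2) * \<xi>\<^sup>2) \<or> (\<exists>x. \<exists>\<delta>>0. \<forall>\<xi>. \<delta> * min 1 (\<xi>\<^sup>2) \<le> q1 x \<xi>)"
      using dichotomy B(2) order_trans by meson
  qed (use B1(1) B2(1) in auto)
qed

section \<open>The two integral criteria\<close>

theorem theorem3p13:
  fixes M1 :: "'w1 measure" and P1 :: "real \<Rightarrow> 'w1 measure" and F1 :: "real \<Rightarrow> 'w1 \<Rightarrow> real"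
    and M2 :: "'w2 measure" and P2 :: "real \<Rightarrow> 'w2 measure" and F2 :: "real \<Rightarrow> 'w2 \<Rightarrow> real"
    and a1 b1 c1 a2 b2 c2 :: "real \<Rightarrow> real" and \<nu>1 \<nu>2 :: "real \<Rightarrow> real measure"
    and q1 q2 :: "real \<Rightarrow> real \<Rightarrow> real"
  assumes process1: "symmetric_nice_feller_process M1 P1 F1 a1 b1 c1 \<nu>1"
    and process2: "symmetric_nice_feller_process M2 P2 F2 a2 b2 c2 \<nu>2"
    and q1: "q1 = (\<lambda>x \<xi>. Re (levy_symbol a1 b1 c1 \<nu>1 x \<xi>))"
    and q2: "q2 = (\<lambda>x \<xi>. Re (levy_symbol a2 b2 c2 \<nu>2 x \<xi>))"
    and unimodal: "uniformly_quasi_unimodal \<nu>1"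
    and tails: "\<exists>y1>0. \<forall>x. \<forall>y\<ge>y1. emeasure (\<nu>1 x) {y<..} \<ge> emeasure (\<nu>2 x) {y<..}"
    and lsc: "\<And>U. open U \<Longrightarrow> lower_semicontinuous (\<lambda>x. emeasure (\<nu>1 x) ((\<lambda>z. z - x) ` U))"
  shows "(\<forall>r>0. (\<integral>\<^sup>+\<xi>\<in>{\<xi>. \<bar>\<xi>\<bar> < r}. 1 / (SUP x. ennreal (q1 x \<xi>)) \<partial>lborel) = \<infinity> \<longrightarrow>
                (\<integral>\<^sup>+\<xi>\<in>{\<xi>. \<bar>\<xi>\<bar> < r}. 1 / (SUP x. ennreal (q2 x \<xi>)) \<partial>lborel) = \<infinity>) \<and>
         (filterlim (\<lambda>\<xi>. (INF x. q1 x \<xi>) / \<xi>\<^sup>2) at_top (at 0) \<longrightarrow>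
          (\<exists>y0>0. (INF x. \<integral>\<^sup>+y\<in>{y0<..}. ennreal y * emeasure (\<nu>1 x) {y<..} \<partial>lborel) > 0) \<longrightarrow>
          (\<exists>r0>0. \<forall>r. 0 < r \<and> r < r0 \<longrightarrow>
             (\<integral>\<^sup>+\<xi>\<in>{\<xi>. \<bar>\<xi>\<bar> < r}. 1 / (INF x. ennreal (q2 x \<xi>)) \<partial>lborel) < \<infinity> \<longrightarrow>
             (\<integral>\<^sup>+\<xi>\<in>{\<xi>. \<bar>\<xi>\<bar> < r}. 1 / (INF x. ennreal (q1 x \<xi>)) \<partial>lborel) < \<infinity>))"
proof (intro conjI impI allI)
  interpret p1: symmetric_nice_feller_process M1 P1 F1 a1 b1 c1 \<nu>1 by fact
  obtain B K where BK: "0 \<le> B" "0 \<le> K" "\<And>x \<xi>. q2 x \<xi> \<le> B * \<xi>\<^sup>2 + K * q1 x \<xi>"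
    and dichotomy: "(\<forall>x \<xi>. q2 x \<xi> \<le> B * \<xi>\<^sup>2) \<or> (\<exists>x. \<exists>\<delta>>0. \<forall>\<xi>. \<delta> * min 1 (\<xi>\<^sup>2) \<le> q1 x \<xi>)"
    using symbol_comparison[OF process1 process2 unimodal tails] unfolding q1 q2 by blast
  have q1_nonneg: "0 \<le> q1 x \<xi>" for x \<xi> by (simp add: q1 p1.symbol_nonneg)
  {
    fix r :: real
    assume r: "0 < r"
      and infinite: "(\<integral>\<^sup>+\<xi>\<in>{\<xi>. \<bar>\<xi>\<bar> < r}. 1 / (SUP x. ennreal (q1 x \<xi>)) \<partial>lborel) = \<infinity>"
    from dichotomy show "(\<integral>\<^sup>+\<xi>\<in>{\<xi>. \<bar>\<xi>\<bar> < r}. 1 / (SUP x. ennreal (q2 x \<xi>)) \<partial>lborel) = \<infinity>"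
    proof
      assume *: "\<forall>x \<xi>. q2 x \<xi> \<le> B * \<xi>\<^sup>2"
      \<comment> \<open>\<open>B\<close> may be 0; \<open>B + 1\<close> is a positive coefficient,
        for which the inverse square integral diverges.\<close>
      have "(SUP x. ennreal (q2 x \<xi>)) \<le> ennreal 1 * ennreal ((B + 1) * \<xi>\<^sup>2)" for \<xi>
      proof (intro SUP_least)
        fix x
        have "q2 x \<xi> \<le> (B + 1) * \<xi>\<^sup>2"
          using *[rule_format, of x \<xi>] by (simp add: distrib_right add_increasing2)
        then show "ennreal (q2 x \<xi>) \<le> ennreal 1 * ennreal ((B + 1) * \<xi>\<^sup>2)"
          by (simp add: ennreal_leI)
      qed
      then have "(\<integral>\<^sup>+\<xi>\<in>{\<xi>. \<bar>\<xi>\<bar> < r}. 1 / ennreal ((B + 1) * \<xi>\<^sup>2) \<partial>lborel)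
          \<le> ennreal 1 * (\<integral>\<^sup>+\<xi>\<in>{\<xi>. \<bar>\<xi>\<bar> < r}. 1 / (SUP x. ennreal (q2 x \<xi>)) \<partial>lborel)"
        by (intro nn_integral_reciprocal_le) auto
      then show ?thesis
        using nn_integral_inverse_square_eq_infinity[of "B + 1" r] BK(1) r by (simp add: top_unique)
    next
      assume "\<exists>x. \<exists>\<delta>>0. \<forall>\<xi>. \<delta> * min 1 (\<xi>\<^sup>2) \<le> q1 x \<xi>"
      then obtain x0 \<delta> where \<delta>: "0 < \<delta>" "\<And>\<xi>. \<delta> * min 1 (\<xi>\<^sup>2) \<le> q1 x0 \<xi>" by blast
      \<comment> \<open>For \<open>\<bar>\<xi>\<bar> < r\<close> one has
        \<open>\<xi>\<^sup>2 \<le> (1 + r\<^sup>2) * min 1 (\<xi>\<^sup>2)\<close>, so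
        \<open>D\<close> makes \<open>B * \<xi>\<^sup>2 \<le> D * q1 x0 \<xi>\<close>. The one state
        \<open>x0\<close> suffices because a supremum over all states stands on the right.\<close>
      define D where "D = B * (1 + r\<^sup>2) / \<delta>"
      have "0 \<le> D" using BK \<delta> by (simp add: D_def)
      have "(SUP x. ennreal (q2 x \<xi>)) \<le> ennreal (D + K + 1) * (SUP x. ennreal (q1 x \<xi>))"
        if "\<bar>\<xi>\<bar> < r" for \<xi>
      proof (intro SUP_least)
        fix x
        let ?S = "SUP x. ennreal (q1 x \<xi>)"
        have S: "ennreal (q1 x \<xi>) \<le> ?S" for x by (rule SUP_upper) simp
        have "\<xi>\<^sup>2 \<le> r\<^sup>2" using that r by (simp add: abs_le_square_iff[symmetric])
        then have "\<xi>\<^sup>2 \<le> (1 + r\<^sup>2) * min 1 (\<xi>\<^sup>2)"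
          by (auto simp: min_def algebra_simps)
        then have "B * \<xi>\<^sup>2 \<le> B * ((1 + r\<^sup>2) * min 1 (\<xi>\<^sup>2))"
          using BK(1) by (rule mult_left_mono)
        also have "\<dots> = D * (\<delta> * min 1 (\<xi>\<^sup>2))" using \<delta>(1) by (simp add: D_def)
        also have "\<dots> \<le> D * q1 x0 \<xi>" using \<delta>(2) \<open>0 \<le> D\<close> by (intro mult_left_mono)
        finally have "q2 x \<xi> \<le> D * q1 x0 \<xi> + K * q1 x \<xi>" using BK(3)[of x \<xi>] by linarith
        then have "ennreal (q2 x \<xi>) \<le> ennreal D * ennreal (q1 x0 \<xi>) + ennreal K * ennreal (q1 x \<xi>)"
          using \<open>0 \<le> D\<close> BK(2) q1_nonneg
          by (simp add: ennreal_mult[symmetric] ennreal_plus[symmetric] ennreal_leI del: ennreal_plus)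
        \<comment> \<open>The extra \<open>?S\<close> keeps the constant positive when
          \<open>D\<close> and \<open>K\<close> vanish.\<close>
        also have "\<dots> \<le> ennreal D * ?S + ennreal K * ?S + ?S"
          by (intro add_increasing2 add_mono mult_left_mono S) auto
        also have "\<dots> = ennreal (D + K + 1) * ?S"
          using \<open>0 \<le> D\<close> BK(2) by (simp add: distrib_right)
        finally show "ennreal (q2 x \<xi>) \<le> ennreal (D + K + 1) * ?S" .
      qed
      then have "(\<integral>\<^sup>+\<xi>\<in>{\<xi>. \<bar>\<xi>\<bar> < r}. 1 / (SUP x. ennreal (q1 x \<xi>)) \<partial>lborel)
          \<le> ennreal (D + K + 1) * (\<integral>\<^sup>+\<xi>\<in>{\<xi>. \<bar>\<xi>\<bar> < r}. 1 / (SUP x. ennreal (q2 x \<xi>)) \<partial>lborel)"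
        using \<open>0 \<le> D\<close> BK(2) by (intro nn_integral_reciprocal_le) auto
      then show ?thesis
        using infinite by (auto simp: top_unique ennreal_mult_eq_top_iff)
    qed
  next
    assume "filterlim (\<lambda>\<xi>. (INF x. q1 x \<xi>) / \<xi>\<^sup>2) at_top (at 0)"
    then have "eventually (\<lambda>\<xi>. 1 \<le> (INF x. q1 x \<xi>) / \<xi>\<^sup>2) (at 0)"
      by (simp add: filterlim_at_top)
    \<comment> \<open>Divergence of the quotient at level 1 gives
      \<open>\<xi>\<^sup>2 \<le> q1 x \<xi>\<close> for all \<open>x\<close> at once, and its radius
      bounds the admissible \<open>r\<close>.\<close>
    then obtain r0 where r0: "0 < r0"
      "\<And>\<xi>. \<xi> \<noteq> 0 \<Longrightarrow> \<bar>\<xi>\<bar> < r0 \<Longrightarrow> 1 \<le> (INF x. q1 x \<xi>) / \<xi>\<^sup>2"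
      by (auto simp: eventually_at dist_real_def)
    have square: "\<xi>\<^sup>2 \<le> q1 x \<xi>" if "\<bar>\<xi>\<bar> < r0" for x \<xi>
    proof (cases "\<xi> = 0")
      case False
      then have "\<xi>\<^sup>2 \<le> (INF x. q1 x \<xi>)" using r0(2)[OF False that] by (simp add: field_simps)
      also have "\<dots> \<le> q1 x \<xi>"
        using q1_nonneg by (intro cINF_lower bdd_belowI[of _ 0]) auto
      finally show ?thesis .
    qed (simp add: q1_nonneg)
    have le: "(INF x. ennreal (q2 x \<xi>)) \<le> ennreal (B + K + 1) * (INF x. ennreal (q1 x \<xi>))"
      if "\<bar>\<xi>\<bar> < r0" for \<xi>
    proof -
      define L where "L = B + K + 1"
      have L: "0 < L" using BK by (simp add: L_def)
      have one: "ennreal L * ennreal (1 / L) = 1"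
        using L by (subst ennreal_mult[symmetric]) auto
      \<comment> \<open>The constant is first moved to the left, so that the infimum of
        \<open>q1\<close> can be taken over a bare right-hand side.\<close>
      have "ennreal (1 / L) * (INF x. ennreal (q2 x \<xi>)) \<le> ennreal (q1 x \<xi>)" for x
      proof -
        have "B * \<xi>\<^sup>2 \<le> B * q1 x \<xi>" using BK(1) square[OF that] by (intro mult_left_mono)
        then have "q2 x \<xi> \<le> L * q1 x \<xi>"
          using BK(3)[of x \<xi>] q1_nonneg[of x \<xi>] by (simp add: L_def algebra_simps)
        then have "1 / L * q2 x \<xi> \<le> q1 x \<xi>" using L by (simp add: field_simps)
        then have "ennreal (1 / L) * ennreal (q2 x \<xi>) \<le> ennreal (q1 x \<xi>)"
          using L by (subst ennreal_mult'[symmetric]) (auto simp: ennreal_leI)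
        then show ?thesis
          by (rule order_trans[rotated]) (intro mult_left_mono INF_lower, auto)
      qed
      then have "ennreal L * (ennreal (1 / L) * (INF x. ennreal (q2 x \<xi>)))
          \<le> ennreal L * (INF x. ennreal (q1 x \<xi>))"
        by (intro mult_left_mono INF_greatest) auto
      then show ?thesis using one by (simp add: L_def mult.assoc[symmetric])
    qed
    have "(\<integral>\<^sup>+\<xi>\<in>{\<xi>. \<bar>\<xi>\<bar> < r}. 1 / (INF x. ennreal (q1 x \<xi>)) \<partial>lborel) < \<infinity>"
      if "r < r0" and fin: "(\<integral>\<^sup>+\<xi>\<in>{\<xi>. \<bar>\<xi>\<bar> < r}. 1 / (INF x. ennreal (q2 x \<xi>)) \<partial>lborel) < \<infinity>" for r
    proof -
      have "(\<integral>\<^sup>+\<xi>\<in>{\<xi>. \<bar>\<xi>\<bar> < r}. 1 / (INF x. ennreal (q1 x \<xi>)) \<partial>lborel)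
          \<le> ennreal (B + K + 1) * (\<integral>\<^sup>+\<xi>\<in>{\<xi>. \<bar>\<xi>\<bar> < r}. 1 / (INF x. ennreal (q2 x \<xi>)) \<partial>lborel)"
        using BK(1,2) \<open>r < r0\<close> by (intro nn_integral_reciprocal_le le) auto
      also have "\<dots> < \<infinity>" using fin by (simp add: ennreal_mult_less_top)
      finally show ?thesis .
    qed
    then show "\<exists>r0>0. \<forall>r. 0 < r \<and> r < r0 \<longrightarrow>
             (\<integral>\<^sup>+\<xi>\<in>{\<xi>. \<bar>\<xi>\<bar> < r}. 1 / (INF x. ennreal (q2 x \<xi>)) \<partial>lborel) < \<infinity> \<longrightarrow>
             (\<integral>\<^sup>+\<xi>\<in>{\<xi>. \<bar>\<xi>\<bar> < r}. 1 / (INF x. ennreal (q1 x \<xi>)) \<partial>lborel) < \<infinity>"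
      using r0(1) by blast
  }
qed

end
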